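(* Let $k$ be a field, $V$ a $k$-vector space, and $T \in \mathrm{End}_k(V)$. If there exists $p(x) \in k[x] \setminus k$ such that $p(T)=0$, then $C(C(T))=\overline{k[T]}= k[T]$.
   Context: $V$ has arbitrary dimension. $\mathrm{End}_k(V)$ is the $k$-algebra of all linear transformations of $V$. For a subset $X$ of the ring $R = \mathrm{End}_k(V)$, $C(X) = \{r \in R \mid rx = xr \text{ for all } x \in X\}$ is the centralizer of $X$ in $R$, and $C(T) = C(\{T\})$. $k[T] = \{q(T) \mid q(x) \in k[x]\}$, and $\overline{k[T]}$ is the closure of $k[T]$ in the function topology on $\mathrm{End}_k(V)$, i.e. the topology having as a base of open sets the sets $\{S \in \mathrm{End}_k(V) \mid S|_W=F|_W\}$, for $F \in \mathrm{End}_k(V)$ and $W \subseteq V$ a finite-dimensional subspace. *)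

theory Defs
  imports "HOL-Analysis.Abstract_Topology" "HOL-Computational_Algebra.Polynomial"
begin

text \<open>
  A vector space is given by its scalar multiplication \<open>s\<close>; the whole type \<open>'v\<close> is the underlying
  set, with no condition on the dimension. The ring product of \<open>End_k(V)\<close> is composition.
\<close>

definition Endo :: "('k::field \<Rightarrow> 'v::ab_group_add \<Rightarrow> 'v) \<Rightarrow> ('v \<Rightarrow> 'v) set"
  where "Endo s = {S. Vector_Spaces.linear s s S}"

definition centralizer ::
    "('k::field \<Rightarrow> 'v::ab_group_add \<Rightarrow> 'v) \<Rightarrow> ('v \<Rightarrow> 'v) set \<Rightarrow> ('v \<Rightarrow> 'v) set"
  where "centralizer s X = {R \<in> Endo s. \<forall>S\<in>X. R \<circ> S = S \<circ> R}"

definition poly_endo ::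
    "('k::field \<Rightarrow> 'v::ab_group_add \<Rightarrow> 'v) \<Rightarrow> 'k poly \<Rightarrow> ('v \<Rightarrow> 'v) \<Rightarrow> ('v \<Rightarrow> 'v)"
  where "poly_endo s q T = (\<lambda>v. \<Sum>i\<le>degree q. s (coeff q i) ((T ^^ i) v))"

definition polys_in ::
    "('k::field \<Rightarrow> 'v::ab_group_add \<Rightarrow> 'v) \<Rightarrow> ('v \<Rightarrow> 'v) \<Rightarrow> ('v \<Rightarrow> 'v) set"
  where "polys_in s T = {poly_endo s q T | q. True}"

definition findim_subspace ::
    "('k::field \<Rightarrow> 'v::ab_group_add \<Rightarrow> 'v) \<Rightarrow> 'v set \<Rightarrow> bool"
  where "findim_subspace s W \<longleftrightarrow>
    module.subspace s W \<and> (\<exists>B. finite B \<and> module.span s B = W)"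

definition function_topology_base ::
    "('k::field \<Rightarrow> 'v::ab_group_add \<Rightarrow> 'v) \<Rightarrow> ('v \<Rightarrow> 'v) set \<Rightarrow> bool"
  where "function_topology_base s U \<longleftrightarrow>
    (\<exists>F W. F \<in> Endo s \<and> findim_subspace s W \<and> U = {S \<in> Endo s. \<forall>w\<in>W. S w = F w})"

definition function_topology ::
    "('k::field \<Rightarrow> 'v::ab_group_add \<Rightarrow> 'v) \<Rightarrow> ('v \<Rightarrow> 'v) topology"
  where "function_topology s = topology (arbitrary union_of (function_topology_base s))"

lemma findim_subspace_span:
  assumes "vector_space s" "finite B"
  shows "findim_subspace s (module.span s B)"
proof -
  interpret vector_space s by fact
  show ?thesis using assms(2) by (auto simp: findim_subspace_def)
qed

lemma function_topology_base_Int: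
  assumes "vector_space s" "function_topology_base s U" "function_topology_base s U'" "G \<in> U \<inter> U'"
  shows "function_topology_base s (U \<inter> U')"
proof -
  interpret vector_space s by fact
  from assms(2) obtain F B where F: "U = {S \<in> Endo s. \<forall>w\<in>span B. S w = F w}" "finite B"
    unfolding function_topology_base_def findim_subspace_def by blast
  from assms(3) obtain F' B' where F': "U' = {S \<in> Endo s. \<forall>w\<in>span B'. S w = F' w}" "finite B'"
    unfolding function_topology_base_def findim_subspace_def by blast
  have G: "G \<in> Endo s" using assms(4) F by blast
  have ext: "S w = G w" if S: "S \<in> Endo s" and eq: "\<forall>w\<in>B \<union> B'. S w = G w" and w: "w \<in> span (B \<union> B')" for S w
  proof -
    interpret vector_space_pair s s by unfold_locales
    show ?thesis
      using linear_eq_on[of S G w "B \<union> B'"] S G eq w by (auto simp: Endo_def)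
  qed
  have "U \<inter> U' = {S \<in> Endo s. \<forall>w\<in>span (B \<union> B'). S w = G w}"
  proof (intro set_eqI iffI)
    fix S assume S: "S \<in> U \<inter> U'"
    have "\<forall>w\<in>B \<union> B'. S w = G w"
      using S assms(4) F(1) F'(1) span_base[of _ B] span_base[of _ B'] by auto
    then show "S \<in> {S \<in> Endo s. \<forall>w\<in>span (B \<union> B'). S w = G w}"
      using S F(1) ext by blast
  next
    fix S assume S: "S \<in> {S \<in> Endo s. \<forall>w\<in>span (B \<union> B'). S w = G w}"
    then show "S \<in> U \<inter> U'"
      using assms(4) F(1) F'(1) span_mono[of B "B \<union> B'"] span_mono[of B' "B \<union> B'"] by auto
  qed
  moreover have "findim_subspace s (span (B \<union> B'))"
    using findim_subspace_span[OF assms(1)] F(2) F'(2) by simp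
  ultimately show ?thesis using G unfolding function_topology_base_def by blast
qed

lemma openin_function_topology:
  assumes "vector_space s"
  shows "openin (function_topology s) = arbitrary union_of (function_topology_base s)"
proof -
  have "istopology (arbitrary union_of (function_topology_base s))"
    unfolding istopology_base_eq
  proof (intro allI impI, elim conjE)
    fix U U' assume U: "function_topology_base s U" "function_topology_base s U'"
    show "(arbitrary union_of (function_topology_base s)) (U \<inter> U')"
    proof (cases "U \<inter> U' = {}")
      case True
      then show ?thesis by (simp add: arbitrary_union_of_empty)
    next
      case False
      then show ?thesis
        using function_topology_base_Int[OF assms U]
        by (auto simp: arbitrary_def intro!: union_of_inc)
    qed
  qed
  then show ?thesis by (simp add: function_topology_def topology_inverse')
qed

lemma topspace_function_topology:
  assumes "vector_space s"
  shows "topspace (function_topology s) = Endo s"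
proof
  interpret vector_space s by fact
  have lin0: "(\<lambda>_. 0) \<in> Endo s"
    unfolding Endo_def mem_Collect_eq by unfold_locales simp_all
  have "Endo s = {S \<in> Endo s. \<forall>w\<in>span {}. S w = 0}"
    by (auto simp: Endo_def linear_iff_module_hom module_hom.zero)
  then have "function_topology_base s (Endo s)"
    using lin0 findim_subspace_span[OF assms, of "{}"]
    unfolding function_topology_base_def by blast
  then have "openin (function_topology s) (Endo s)"
    by (simp add: openin_function_topology[OF assms] arbitrary_def union_of_inc)
  then show "Endo s \<subseteq> topspace (function_topology s)"
    by (rule openin_subset)
  have "openin (function_topology s) (topspace (function_topology s))"
    by simp
  then show "topspace (function_topology s) \<subseteq> Endo s"
    unfolding openin_function_topology[OF assms] union_of_def function_topology_base_def
    by blast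
qed

end

(* Let m be the minimal polynomial of T, of degree d, and v0 a vector whose annihilator is exactly
   (m). The cyclic module k[T] v0 = k[x]/(m) is self-injective, so every w is the image of v0 under
   an endomorphism phi_w commuting with T whose values are k[T]-combinations of w with coefficients
   independent of w; phi_w is written down explicitly with dual bases. If S commutes with C(T), then
   S w = S (phi_w v0) = phi_w (S v0), which is q(T) w for one polynomial q. Since centralizers are
   closed, k[T] = C(C(T)) is closed. *)
theory Submission
  imports Defs "HOL-Computational_Algebra.Polynomial_Factorial"
begin

section \<open>Ideals and prime factors of polynomials over a field\<close>

text \<open>A nonzero element of least degree generates: the remainder of division by it lies in
  \<open>I\<close> again and has smaller degree. Applied below to the ideal of polynomials killing a
  vector.\<close>

lemma poly_ideal_principal:
  fixes I :: "'k::field poly set"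
  assumes add: "\<And>f g. f \<in> I \<Longrightarrow> g \<in> I \<Longrightarrow> f + g \<in> I"
    and mult: "\<And>f g. g \<in> I \<Longrightarrow> f * g \<in> I"
    and p: "p \<in> I" "p \<noteq> 0"
  obtains a where "a \<noteq> 0" "\<And>f. f \<in> I \<longleftrightarrow> a dvd f"
proof -
  obtain a where a: "a \<in> I" "a \<noteq> 0"
    and least: "\<And>f. f \<in> I \<Longrightarrow> f \<noteq> 0 \<Longrightarrow> degree a \<le> degree f"
    using ex_has_least_nat[of "\<lambda>f. f \<in> I \<and> f \<noteq> 0" p degree] p by auto
  have "a dvd f" if f: "f \<in> I" for f
  proof (rule ccontr)
    assume nd: "\<not> a dvd f"
    have "f + (- (f div a)) * a \<in> I"
      using add mult f a(1) by blast
    moreover have "f mod a = f + (- (f div a)) * a"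
      by (simp add: minus_div_mult_eq_mod [symmetric])
    ultimately have "f mod a \<in> I"
      by simp
    then have "degree a \<le> degree (f mod a)"
      using least nd by (simp add: dvd_eq_mod_eq_0)
    then show False
      using degree_mod_less_degree[OF a(2) nd] by simp
  qed
  moreover have "f \<in> I" if "a dvd f" for f
    using that mult[OF a(1)] by (metis dvdE mult.commute)
  ultimately have "f \<in> I \<longleftrightarrow> a dvd f" for f
    by (rule iffI)
  with a(2) show thesis
    by (rule that)
qed

text \<open>A nonconstant divisor of least degree is irreducible, since a proper factor of it would
  be a smaller such divisor.\<close>

lemma field_poly_prime_divisor:
  fixes p :: "'k::field poly"
  assumes "degree p > 0"
  obtains q where "prime_elem q" "q dvd p"
proof -
  obtain q where q: "q dvd p" "degree q > 0"
    and least: "\<And>r. r dvd p \<Longrightarrow> degree r > 0 \<Longrightarrow> degree q \<le> degree r"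
    using ex_has_least_nat[of "\<lambda>q. q dvd p \<and> degree q > 0" p degree] assms by auto
  have nz: "q \<noteq> 0"
    using q(2) by auto
  have "irreducible q"
  proof (rule irreducibleI)
    show "q \<noteq> 0" "\<not> is_unit q"
      using q(2) nz by (auto simp: is_unit_iff_degree)
    show "is_unit a \<or> is_unit b" if ab: "q = a * b" for a b
    proof -
      have "a \<noteq> 0" "b \<noteq> 0" "a dvd p"
        using ab nz q(1) by (auto dest: dvd_mult_left)
      moreover from this have "degree a = 0 \<or> degree b = 0"
        using least[of a] by (cases "degree a = 0") (simp_all add: ab degree_mult_eq)
      ultimately show ?thesis
        by (simp add: is_unit_iff_degree)
    qed
  qed
  then show thesis
    using that q(1) field_poly_irreducible_imp_prime by blast
qed

lemma field_poly_prime_power_decomp: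
  fixes p x :: "'k::field poly"
  assumes "prime_elem p" "x \<noteq> 0"
  obtains n y where "x = p ^ n * y" "\<not> p dvd y"
proof -
  have degp: "degree p > 0"
    using assms(1) by (metis gr0I is_unit_iff_degree prime_elem_def)
  have "n \<le> degree x" if "p ^ n dvd x" for n
  proof -
    have "n \<le> degree (p ^ n)"
      using degp by (subst degree_power_eq) auto
    then show ?thesis
      using dvd_imp_degree_le[OF that assms(2)] by simp
  qed
  then obtain n where n: "p ^ n dvd x" and max: "\<And>k. p ^ k dvd x \<Longrightarrow> k \<le> n"
    using Nat.ex_has_greatest_nat[of "\<lambda>n. p ^ n dvd x" 0 "degree x"] by auto
  obtain y where y: "x = p ^ n * y"
    using n by (elim dvdE)
  have "\<not> p dvd y"
  proof
    assume "p dvd y"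
    then have "p ^ Suc n dvd x"
      by (simp add: y mult_dvd_mono mult.commute)
    then show False
      using max by fastforce
  qed
  then show thesis
    using that y by blast
qed

text \<open>Strip the full \<open>q\<close>-part \<open>q ^ e\<close> for one prime divisor
  \<open>q\<close> of \<open>b\<close> from both \<open>b\<close> and \<open>m\<close>, and recurse
  on the cofactors.\<close>

lemma dvd_if_prime_powers_dvd:
  fixes b m :: "'k::field poly"
  assumes "b \<noteq> 0" "\<And>q n. prime_elem q \<Longrightarrow> q ^ n dvd b \<Longrightarrow> q ^ n dvd m"
  shows "b dvd m"
  using assms
proof (induction "degree b" arbitrary: b m rule: less_induct)
  case less
  show ?case
  proof (cases "degree b = 0")
    case True
    then show ?thesis
      using less.prems(1) is_unit_iff_degree unit_imp_dvd by blast
  next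
    case False
    then obtain q where q: "prime_elem q" "q dvd b"
      using field_poly_prime_divisor by blast
    obtain e c where c: "b = q ^ e * c" "\<not> q dvd c"
      using field_poly_prime_power_decomp[OF q(1) less.prems(1)] .
    obtain m' where m': "m = q ^ e * m'"
      using less.prems(2)[OF q(1), of e] c(1) by (auto elim: dvdE)
    have nz: "q \<noteq> 0" "c \<noteq> 0"
      using less.prems(1) c q(1) by auto
    have "e \<noteq> 0"
      using q(2) c by (metis mult_1 power_0)
    moreover have "degree q > 0"
      using q(1) nz by (metis gr0I is_unit_iff_degree prime_elem_def)
    ultimately have "degree c < degree b"
      using nz by (simp add: c(1) degree_mult_eq degree_power_eq)
    \<comment> \<open>The hypothesis passes to the cofactors: a prime \<open>r\<close> dividing
      \<open>c\<close> is not associated to \<open>q\<close>, as \<open>q\<close> does not divide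
      \<open>c\<close>. So \<open>r ^ n\<close> is coprime to \<open>q ^ e\<close> and has to divide
      \<open>m'\<close>.\<close>
    moreover have "r ^ n dvd m'" if r: "prime_elem r" and n: "r ^ n dvd c" for r n
    proof (cases "n = 0")
      case False
      have "\<not> r dvd q ^ e"
      proof
        assume "r dvd q ^ e"
        then have "r dvd q"
          using r by (metis prime_elem_dvd_power)
        then have "q dvd r"
          using q(1) r by (metis irreducibleD' prime_elem_imp_irreducible prime_elem_not_unit)
        then show False
          using False n c(2) by (meson dvd_power dvd_trans neq0_conv)
      qed
      moreover have "r ^ n dvd q ^ e * m'"
        using less.prems(2)[OF r] n by (simp add: c(1) m')
      ultimately show ?thesis
        using prime_power_dvd_multD[OF r] False by blast
    qed simp
    ultimately have "c dvd m'"
      using less.hyps nz(2) by blast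
    then show ?thesis
      by (simp add: c(1) m')
  qed
qed

section \<open>Separating functionals and centralizers\<close>

context vector_space
begin

text \<open>A basis of \<open>U\<close> stays independent when \<open>u\<close> is added, so the
  values 0 on it and 1 at \<open>u\<close> can be prescribed.\<close>

lemma linear_functional_separating:
  assumes "subspace U" "u \<notin> U"
  obtains l where "Vector_Spaces.linear scale (*) l" "\<And>x. x \<in> U \<Longrightarrow> l x = 0" "l u = 1"
proof -
  interpret vector_space_pair scale "(*) :: 'a \<Rightarrow> 'a \<Rightarrow> 'a"
    by unfold_locales (simp_all add: algebra_simps)
  obtain B where B: "B \<subseteq> U" "independent B" "U \<subseteq> span B"
    using maximal_independent_subset by blast
  have spanB: "span B = U"
    using B assms(1) by (simp add: span_minimal subset_antisym)
  have "independent (insert u B)"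
    using B(2) assms(2) spanB by (intro independent_insertI) auto
  then obtain l where l: "Vector_Spaces.linear scale (*) l"
    and vals: "\<forall>x\<in>insert u B. l x = (if x = u then 1 else 0)"
    using linear_independent_extend[of _ "\<lambda>x. if x = u then 1 else 0"] by blast
  have "l x = 0" if "x \<in> U" for x
  proof (rule linear_eq_0_on_span[OF l])
    show "l b = 0" if "b \<in> B" for b
      using vals that assms(2) B(1) by auto
    show "x \<in> span B"
      using that spanB by simp
  qed
  then show thesis
    using that l vals by simp
qed

end

lemma centralizerD:
  assumes "R \<in> centralizer s X" "S \<in> X"
  shows "R (S v) = S (R v)"
proof -
  have "R \<circ> S = S \<circ> R"
    using assms by (simp add: centralizer_def)
  then show ?thesis
    by (rule comp_eq_dest)
qed

section \<open>Calculus of polynomials in \<open>T\<close>\<close>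

locale linear_endo = Vector_Spaces.linear s s T
  for s :: "'k::field \<Rightarrow> 'v::ab_group_add \<Rightarrow> 'v" and T :: "'v \<Rightarrow> 'v"
begin

abbreviation ap :: "'k poly \<Rightarrow> 'v \<Rightarrow> 'v"
  where "ap q \<equiv> poly_endo s q T"

text \<open>Lets polynomials of different degrees share one range of summation.\<close>

lemma poly_endo_le:
  assumes "degree q \<le> n"
  shows "ap q v = (\<Sum>i\<le>n. s (coeff q i) ((T ^^ i) v))"
  unfolding poly_endo_def using assms
  by (intro sum.mono_neutral_left) (auto simp: coeff_eq_0)

lemma poly_endo_0 [simp]: "ap 0 v = 0"
  by (simp add: poly_endo_def)

text \<open>Horner's rule, the form in which inductions over polynomials use
  \<open>poly_endo\<close>.\<close>

lemma poly_endo_pCons: "ap (pCons a q) v = s a v + T (ap q v)"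
proof -
  have "ap (pCons a q) v = (\<Sum>i\<le>Suc (degree q). s (coeff (pCons a q) i) ((T ^^ i) v))"
    by (rule poly_endo_le) (rule degree_pCons_le)
  also have "\<dots> = s a v + (\<Sum>i\<le>degree q. s (coeff q i) (T ((T ^^ i) v)))"
    by (simp add: sum.atMost_Suc_shift del: sum.atMost_Suc)
  finally show ?thesis
    by (simp add: poly_endo_def sum scale)
qed

lemma poly_endo_1 [simp]: "ap 1 v = v"
  by (simp add: poly_endo_def)

lemma poly_endo_add: "ap (p + q) v = ap p v + ap q v"
proof -
  let ?n = "max (degree p) (degree q)"
  have "degree (p + q) \<le> ?n"
    by (rule degree_add_le) auto
  then show ?thesis
    using poly_endo_le[of "p + q" ?n] poly_endo_le[of p ?n] poly_endo_le[of q ?n]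
    by (simp add: vs1.scale_left_distrib sum.distrib)
qed

lemma poly_endo_smult: "ap (smult c p) v = s c (ap p v)"
  using poly_endo_le[of "smult c p" "degree p"]
  by (simp add: poly_endo_def vs1.scale_sum_right)

lemma poly_endo_diff: "ap (p - q) v = ap p v - ap q v"
  using poly_endo_add[of "p - q" q v] by (simp add: algebra_simps)

lemma poly_endo_mult: "ap (p * q) v = ap p (ap q v)"
  by (induction p) (simp_all add: poly_endo_pCons poly_endo_add poly_endo_smult)

lemma commuting_funpow:
  assumes "S \<circ> T = T \<circ> S"
  shows "S ((T ^^ i) v) = (T ^^ i) (S v)"
  by (induction i) (simp_all add: assms[THEN fun_cong, simplified])

lemma linear_commuting_poly_endo:
  assumes "Vector_Spaces.linear s s S" "S \<circ> T = T \<circ> S"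
  shows "S (ap q v) = ap q (S v)"
proof -
  interpret S: Vector_Spaces.linear s s S by fact
  show ?thesis
    by (simp add: poly_endo_def S.sum S.scale commuting_funpow[OF assms(2)])
qed

lemma linear_poly_endo: "Vector_Spaces.linear s s (ap q)"
proof -
  have "ap q (v + w) = ap q v + ap q w" for v w
    by (induction q) (simp_all add: poly_endo_pCons vs1.scale_right_distrib add algebra_simps)
  moreover have "ap q (s c v) = s c (ap q v)" for c v
    by (induction q)
      (simp_all add: poly_endo_pCons vs1.scale_right_distrib scale vs1.scale_left_commute)
  ultimately show ?thesis
    by unfold_locales
qed

lemma poly_endo_add_right: "ap q (v + w) = ap q v + ap q w"
  using linear_poly_endo[of q] by (simp add: Vector_Spaces.linear_iff)

lemma poly_endo_0_right [simp]: "ap q 0 = 0"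
  using poly_endo_add_right[of q 0 0] by simp

lemma poly_endo_T: "ap q (T v) = T (ap q v)"
  by (induction q) (simp_all add: poly_endo_pCons add scale)

section \<open>Annihilators of vectors\<close>

text \<open>The generator is determined only up to a unit; no monic choice is made, since only
  degrees and divisibility matter.\<close>

definition annihilated_by :: "'v \<Rightarrow> 'k poly \<Rightarrow> bool"
  where "annihilated_by v a \<longleftrightarrow> a \<noteq> 0 \<and> (\<forall>f. ap f v = 0 \<longleftrightarrow> a dvd f)"

lemma annihilator_exists:
  assumes "p \<noteq> 0" "ap p v = 0"
  obtains a where "annihilated_by v a"
proof -
  obtain a where "a \<noteq> 0" "\<And>f. f \<in> {f. ap f v = 0} \<longleftrightarrow> a dvd f"
    by (rule poly_ideal_principal[of "{f. ap f v = 0}" p])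
      (use assms in \<open>auto simp: poly_endo_add poly_endo_mult\<close>)
  then show thesis
    using that by (auto simp: annihilated_by_def)
qed

lemma annihilated_by_poly_endo:
  assumes "annihilated_by v (a * b)"
  shows "annihilated_by (ap a v) b"
proof -
  have "ap f (ap a v) = 0 \<longleftrightarrow> b dvd f" for f
  proof -
    have "ap f (ap a v) = 0 \<longleftrightarrow> a * b dvd a * f"
      using assms by (metis annihilated_by_def mult.commute poly_endo_mult)
    then show ?thesis
      using assms by (auto simp: annihilated_by_def)
  qed
  then show ?thesis
    using assms by (auto simp: annihilated_by_def)
qed

text \<open>Coprime annihilators multiply: if \<open>f\<close> kills the sum, then
  \<open>b * f\<close> kills \<open>v\<close> and \<open>p ^ n * f\<close> kills \<open>w\<close>,
  and coprimality removes the extra factors.\<close>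

lemma annihilated_by_add:
  assumes v: "annihilated_by v (p ^ n)" and w: "annihilated_by w b"
    and p: "prime_elem p" and nd: "\<not> p dvd b"
  shows "annihilated_by (v + w) (p ^ n * b)"
proof -
  have kill: "ap (p ^ n * f) v = 0" "ap (b * f) w = 0" for f
    using v w by (auto simp: annihilated_by_def)
  have nz: "p \<noteq> 0" "b \<noteq> 0"
    using p w by (auto simp: annihilated_by_def prime_elem_def)
  have cop: "p ^ n dvd g" if "p ^ n dvd b * g" for g
    using prime_power_dvd_multD[OF p that _ nd] by (cases "n = 0") auto
  have "ap f (v + w) = 0 \<longleftrightarrow> p ^ n * b dvd f" for f
  proof
    assume f: "ap f (v + w) = 0"
    have "ap (g * f) v + ap (g * f) w = 0" for g
      using f by (simp add: poly_endo_mult flip: poly_endo_add_right)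
    from this[of b] this[of "p ^ n"] have "ap (b * f) v = 0" "ap (p ^ n * f) w = 0"
      using kill by simp_all
    then have "p ^ n dvd b * f" "b dvd p ^ n * f"
      using v w by (simp_all add: annihilated_by_def)
    then obtain g h where g: "f = p ^ n * g" and h: "p ^ n * f = b * h"
      by (metis cop dvdE)
    \<comment> \<open>Cancelling \<open>p ^ n\<close> from \<open>p ^ n * f = b * h\<close> will
      give \<open>f = b * k\<close>; as \<open>p ^ n\<close> divides \<open>f\<close> and is coprime
      to \<open>b\<close>, it divides \<open>k\<close>.\<close>
    then obtain k where k: "h = p ^ n * k"
      by (metis cop dvdE dvd_triv_left)
    then have fk: "f = b * k"
      using h nz by simp
    then have "p ^ n dvd k"
      using g cop by (metis dvd_triv_left)
    then show "p ^ n * b dvd f"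
      unfolding fk by (subst mult.commute) (rule mult_dvd_mono[OF dvd_refl])
  next
    assume "p ^ n * b dvd f"
    then obtain g where g: "f = p ^ n * b * g"
      by (elim dvdE)
    have "ap f v = 0" "ap f w = 0"
      using kill(1)[of "b * g"] kill(2)[of "p ^ n * g"] by (simp_all add: g algebra_simps)
    then show "ap f (v + w) = 0"
      by (simp add: poly_endo_add_right)
  qed
  then show ?thesis
    using nz by (simp add: annihilated_by_def)
qed

text \<open>A vector whose annihilator has maximal degree is annihilated by the minimal polynomial only:
  otherwise some prime power \<open>q ^ e\<close> divides the annihilator \<open>b\<close> of another vector but not the
  maximal one, and exchanging the \<open>q\<close>-parts increases the degree.\<close>
lemma cyclic_vector_exists:
  assumes "p \<noteq> 0" "\<And>v. ap p v = 0"
  obtains m v0 where "annihilated_by v0 m" "\<And>v. ap m v = 0"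
proof -
  let ?P = "\<lambda>a. \<exists>v. annihilated_by v a"
  let ?D = "\<lambda>n. \<exists>a. ?P a \<and> degree a = n"
  obtain a0 v where "annihilated_by v a0"
    using annihilator_exists[OF assms(1) assms(2)] by blast
  then have "?D (degree a0)"
    by blast
  \<comment> \<open>Every annihilator divides \<open>p\<close>, so the degrees are bounded and a
    maximum exists.\<close>
  moreover have "n \<le> degree p" if "?D n" for n
    using that assms by (auto simp: annihilated_by_def intro!: dvd_imp_degree_le)
  ultimately obtain n where n: "?D n" "\<And>k. ?D k \<Longrightarrow> k \<le> n"
    using Nat.ex_has_greatest_nat[of ?D "degree a0" "degree p"] by metis
  then obtain m where m: "?P m" and max: "\<And>a. ?P a \<Longrightarrow> degree a \<le> degree m"
    by metis
  then obtain v0 where v0: "annihilated_by v0 m"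
    by blast
  have "ap m w = 0" for w
  proof -
    obtain b where b: "annihilated_by w b"
      using annihilator_exists[OF assms(1) assms(2)] by blast
    have "b dvd m"
    proof (rule ccontr)
      assume nd: "\<not> b dvd m"
      have b0: "b \<noteq> 0" and m0: "m \<noteq> 0"
        using b v0 by (auto simp: annihilated_by_def)
      obtain q e where q: "prime_elem q" "q ^ e dvd b" "\<not> q ^ e dvd m"
        using dvd_if_prime_powers_dvd[OF b0] nd by blast
      have degq: "degree q > 0"
        using q(1) by (metis gr0I is_unit_iff_degree prime_elem_def)
      obtain c where c: "b = q ^ e * c"
        using q(2) by (elim dvdE)
      obtain j a where a: "m = q ^ j * a" "\<not> q dvd a"
        using field_poly_prime_power_decomp[OF q(1) m0] .
      have "j < e"
        using q(3) a(1) by (metis dvd_mult2 le_imp_power_dvd not_less)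
      \<comment> \<open>The exchange: the sum of these two vectors has annihilator
        \<open>q ^ e * a\<close>, of larger degree than \<open>m = q ^ j * a\<close> because
        \<open>j < e\<close>.\<close>
      have "annihilated_by (ap c w) (q ^ e)"
        using annihilated_by_poly_endo[of w c "q ^ e"] b c by (simp add: mult.commute)
      moreover have "annihilated_by (ap (q ^ j) v0) a"
        using annihilated_by_poly_endo v0 a(1) by simp
      ultimately have "degree (q ^ e * a) \<le> degree m"
        using annihilated_by_add[OF _ _ q(1) a(2)] max by blast
      moreover have "q \<noteq> 0" "a \<noteq> 0"
        using m0 a q(1) by auto
      ultimately show False
        using \<open>j < e\<close> degq by (simp add: a(1) degree_mult_eq degree_power_eq)
    qed
    then show ?thesis
      using b by (auto simp: annihilated_by_def)
  qed
  then show thesis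
    using that v0 by blast
qed

section \<open>Dual bases and endomorphisms commuting with \<open>T\<close>\<close>

text \<open>With d the degree of \<open>m\<close>, on k[x]/(m) the functional should read off the
  coefficient of x^(d-1), divided by the leading coefficient of \<open>m\<close>. The polynomial
  \<open>poly_shift 1 m\<close> has degree d-1 and the later shifts have smaller degree, so it
  suffices to separate \<open>?u\<close> from the span \<open>?U\<close> of the lower
  powers.\<close>

lemma coefficient_functional_exists:
  assumes v0: "annihilated_by v0 m" and deg: "degree m > 0"
  obtains l where "Vector_Spaces.linear s (*) l"
    and "\<And>i. i < degree m \<Longrightarrow> l (ap (poly_shift (Suc i) m) v0) = (if i = 0 then 1 else 0)"
proof -
  let ?U = "{ap q v0 | q. \<forall>i\<ge>degree m - 1. coeff q i = 0}"
  let ?u = "ap (poly_shift 1 m) v0"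
  have "vs1.subspace ?U"
  proof (rule vs1.subspaceI)
    show "0 \<in> ?U"
      by (auto intro!: exI[of _ 0])
    show "x + y \<in> ?U" if x: "x \<in> ?U" and y: "y \<in> ?U" for x y
    proof -
      from x y obtain p q where "x = ap p v0" "y = ap q v0"
        "\<forall>i\<ge>degree m - 1. coeff p i = 0" "\<forall>i\<ge>degree m - 1. coeff q i = 0"
        by auto
      then show ?thesis
        by (auto intro!: exI[of _ "p + q"] simp: poly_endo_add)
    qed
    show "s c x \<in> ?U" if x: "x \<in> ?U" for c x
    proof -
      from x obtain p where "x = ap p v0" "\<forall>i\<ge>degree m - 1. coeff p i = 0"
        by auto
      then show ?thesis
        by (auto intro!: exI[of _ "smult c p"] simp: poly_endo_smult)
    qed
  qed
  moreover have "?u \<notin> ?U"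
  proof
    assume "?u \<in> ?U"
    then obtain q where q: "?u = ap q v0" "\<forall>i\<ge>degree m - 1. coeff q i = 0"
      by auto
    \<comment> \<open>The coefficient of \<open>?r\<close> at d-1 is that of
      \<open>poly_shift 1 m\<close>, hence nonzero; so \<open>?r\<close> is nonzero of degree below
      d and \<open>m\<close> cannot divide it.\<close>
    let ?r = "poly_shift 1 m - q"
    have "ap ?r v0 = 0"
      using q(1) by (simp add: poly_endo_diff)
    then have "m dvd ?r"
      using v0 by (simp add: annihilated_by_def)
    moreover have "coeff ?r (degree m - 1) \<noteq> 0"
      using deg q(2) by (simp add: coeff_poly_shift) auto
    moreover have "degree ?r \<le> degree m - 1"
      using q(2) by (intro degree_le) (simp add: coeff_poly_shift coeff_eq_0)
    ultimately show False
      using deg dvd_imp_degree_le[of m ?r] by fastforce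
  qed
  ultimately obtain l where l: "Vector_Spaces.linear s (*) l"
    and zero: "\<And>x. x \<in> ?U \<Longrightarrow> l x = 0" and one: "l ?u = 1"
    using vs1.linear_functional_separating by blast
  have "l (ap (poly_shift (Suc i) m) v0) = 0" if "0 < i" for i
    using that by (intro zero) (auto simp: coeff_poly_shift coeff_eq_0)
  then show thesis
    using that l one by (metis One_nat_def neq0_conv)
qed

text \<open>The polynomials \<open>poly_shift (Suc i) m\<close> are the coefficients at \<open>y ^ i\<close> of
  \<open>(m(x) - m(y)) / (x - y)\<close>, that is, up to the functional \<open>l\<close>, the basis dual to the powers
  of \<open>x\<close> modulo \<open>m\<close>. This makes the map below commute with \<open>T\<close>.\<close>
definition cyclic_hom :: "('v \<Rightarrow> 'k) \<Rightarrow> 'k poly \<Rightarrow> 'v \<Rightarrow> 'v \<Rightarrow> 'v"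
  where "cyclic_hom l m w v =
    (\<Sum>i<degree m. s (l (ap (poly_shift (Suc i) m) v)) ((T ^^ i) w))"

lemma cyclic_hom_in_centralizer:
  assumes l: "Vector_Spaces.linear s (*) l" and m: "\<And>v. ap m v = 0"
  shows "cyclic_hom l m w \<in> centralizer s {T}"
proof -
  interpret l: Vector_Spaces.linear s "(*)" l by fact
  let ?\<phi> = "cyclic_hom l m w"
  have "Vector_Spaces.linear s s ?\<phi>"
  proof unfold_locales
    show "?\<phi> (x + y) = ?\<phi> x + ?\<phi> y" for x y
      by (simp add: cyclic_hom_def poly_endo_add_right l.add vs1.scale_left_distrib sum.distrib)
    show "?\<phi> (s c x) = s c (?\<phi> x)" for c x
      using linear_poly_endo
      by (simp add: cyclic_hom_def Vector_Spaces.linear_iff l.scale vs1.scale_sum_right)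
  qed
  moreover have "?\<phi> (T v) = T (?\<phi> v)" for v
  proof -
    let ?n = "degree m"
    let ?c = "\<lambda>i. l (ap (poly_shift i m) v)"
    have shift: "pCons (coeff m i) (poly_shift (Suc i) m) = poly_shift i m" for i
      by (rule poly_eqI) (simp add: coeff_poly_shift coeff_pCons split: nat.split)
    \<comment> \<open>Replacing \<open>v\<close> by \<open>T v\<close> lowers the shift by one, up
      to a correction. The corrections will add up to a multiple of \<open>ap m w\<close>, which
      vanishes.\<close>
    have rec: "l (ap (poly_shift (Suc i) m) (T v)) = ?c i - coeff m i * l v" for i
    proof -
      have "ap (poly_shift i m) v = s (coeff m i) v + ap (poly_shift (Suc i) m) (T v)"
        by (metis shift poly_endo_pCons poly_endo_T)
      then show ?thesis
        by (simp add: l.add l.scale)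
    qed
    \<comment> \<open>At i = d the right side of \<open>rec\<close> is zero, so the sum may be
      extended to i = d and the whole of \<open>m\<close> appears in the corrections.\<close>
    have "poly_shift ?n m = [:lead_coeff m:]"
      by (rule poly_eqI) (simp add: coeff_poly_shift coeff_pCons coeff_eq_0 split: nat.split)
    then have top: "?c ?n = coeff m ?n * l v"
      by (simp add: poly_endo_pCons l.scale)
    have "?\<phi> (T v) = (\<Sum>i\<le>?n. s (?c i - coeff m i * l v) ((T ^^ i) w))"
      unfolding cyclic_hom_def rec by (simp add: top flip: lessThan_Suc_atMost)
    also have "\<dots> = (\<Sum>i\<le>?n. s (?c i) ((T ^^ i) w)) - s (l v) (ap m w)"
      by (simp add: poly_endo_def vs1.scale_left_diff_distrib sum_subtractf vs1.scale_sum_right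
          mult.commute)
    \<comment> \<open>The term i = 0 drops out as well: its coefficient is
      \<open>l (ap m v)\<close>, which is 0.\<close>
    also have "\<dots> = (\<Sum>i<?n. s (?c (Suc i)) (T ((T ^^ i) w)))"
      by (simp add: m sum.atMost_shift)
    also have "\<dots> = T (?\<phi> v)"
      by (simp add: cyclic_hom_def sum scale)
    finally show ?thesis .
  qed
  ultimately show ?thesis
    by (auto simp: centralizer_def Endo_def)
qed

text \<open>The coefficients in \<open>cyclic_hom\<close> involve \<open>v\<close> but not
  \<open>w\<close>, so one \<open>q\<close> serves all \<open>w\<close>.\<close>

lemma cyclic_hom_eq_poly_endo: "\<exists>q. \<forall>w. cyclic_hom l m w v = ap q w"
proof -
  have "\<exists>q. \<forall>w. (\<Sum>i<n. s (c i) ((T ^^ i) w)) = ap q w" for n :: nat and c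
  proof (induction n)
    case 0
    then show ?case
      by (auto intro: exI[of _ 0])
  next
    case (Suc n)
    then obtain q where "\<forall>w. (\<Sum>i<n. s (c i) ((T ^^ i) w)) = ap q w"
      by blast
    moreover have "ap (monom a n) w = s a ((T ^^ n) w)" for a w
      by (induction n) (simp_all add: monom_0 monom_Suc poly_endo_pCons scale)
    ultimately show ?case
      by (auto intro!: exI[of _ "q + monom (c n) n"] simp: poly_endo_add)
  qed
  then show ?thesis
    by (simp add: cyclic_hom_def)
qed

section \<open>The double centralizer\<close>

lemma double_centralizer_subset:
  assumes "p \<noteq> 0" "\<And>v. ap p v = 0"
  shows "centralizer s (centralizer s {T}) \<subseteq> polys_in s T"
proof
  fix S assume S: "S \<in> centralizer s (centralizer s {T})"
  obtain m v0 where v0: "annihilated_by v0 m" and m: "\<And>v. ap m v = 0"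
    by (rule cyclic_vector_exists[OF assms]) (rule that)
  show "S \<in> polys_in s T"
  proof (cases "degree m = 0")
    \<comment> \<open>Here \<open>m\<close> is a unit that kills everything, so the space is zero.
      The functional \<open>l\<close> exists only for positive degree.\<close>
    case True
    then have "m dvd 1"
      using v0 by (simp add: annihilated_by_def is_unit_iff_degree)
    then obtain r where r: "1 = m * r"
      by (elim dvdE)
    have "v = 0" for v :: 'v
    proof -
      have "v = ap (m * r) v"
        by (simp flip: r)
      then show ?thesis
        by (simp add: poly_endo_mult m)
    qed
    then have "S = ap 0"
      by (intro ext) metis
    then show ?thesis
      by (auto simp: polys_in_def)
  next
    case False
    then obtain l where l: "Vector_Spaces.linear s (*) l"
      and dual: "\<And>i. i < degree m \<Longrightarrow>
        l (ap (poly_shift (Suc i) m) v0) = (if i = 0 then 1 else 0)"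
      using coefficient_functional_exists[OF v0] by auto
    let ?\<phi> = "cyclic_hom l m"
    have comm: "S (?\<phi> w v) = ?\<phi> w (S v)" for v w
      using S cyclic_hom_in_centralizer[OF l m] by (rule centralizerD)
    \<comment> \<open>By duality only the term i = 0 survives at \<open>v0\<close>.\<close>
    have val: "?\<phi> w v0 = w" for w
    proof -
      have "?\<phi> w v0 = (\<Sum>i<degree m. if i = 0 then w else 0)"
        unfolding cyclic_hom_def by (rule sum.cong) (auto simp: dual)
      then show ?thesis
        using False by simp
    qed
    obtain q where q: "\<And>w. ?\<phi> w (S v0) = ap q w"
      using cyclic_hom_eq_poly_endo by blast
    have "S w = ap q w" for w
      using comm[of w v0] by (simp add: val q)
    then have "S = ap q"
      by (rule ext)
    then show ?thesis
      by (auto simp: polys_in_def)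
  qed
qed

lemma polys_in_subset_double_centralizer:
  "polys_in s T \<subseteq> centralizer s (centralizer s {T})"
proof -
  have "ap q \<in> centralizer s (centralizer s {T})" for q
    using linear_poly_endo linear_commuting_poly_endo
    by (simp add: centralizer_def Endo_def fun_eq_iff) metis
  then show ?thesis
    by (auto simp only: polys_in_def)
qed

end

section \<open>Closedness in the function topology\<close>

text \<open>Commuting with \<open>S\<close> at \<open>v\<close> involves only the values at
  \<open>v\<close> and \<open>S v\<close>, and a point of the closure agrees with some element of
  the centralizer on the span of these two vectors.\<close>

lemma closedin_centralizer:
  fixes s :: "'k::field \<Rightarrow> 'v::ab_group_add \<Rightarrow> 'v"
  assumes "vector_space s"
  shows "closedin (function_topology s) (centralizer s X)"
proof -
  interpret vector_space s by fact
  have "function_topology s closure_of centralizer s X \<subseteq> centralizer s X"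
  proof
    fix F assume F: "F \<in> function_topology s closure_of centralizer s X"
    then have FE: "F \<in> Endo s"
      by (simp add: in_closure_of topspace_function_topology[OF assms])
    have "F (S v) = S (F v)" if S: "S \<in> X" for S v
    proof -
      let ?W = "span {v, S v}"
      let ?N = "{R \<in> Endo s. \<forall>w\<in>?W. R w = F w}"
      have "function_topology_base s ?N"
        using FE findim_subspace_span[OF assms, of "{v, S v}"]
        unfolding function_topology_base_def by blast
      then have "openin (function_topology s) ?N"
        by (simp add: openin_function_topology[OF assms] arbitrary_def union_of_inc)
      moreover have "F \<in> ?N"
        using FE by simp
      ultimately have "\<exists>R. R \<in> centralizer s X \<and> R \<in> ?N"
        using F[unfolded in_closure_of, THEN conjunct2, THEN spec, of ?N] by (simp only:)
      then obtain R where R: "R \<in> centralizer s X" "R \<in> ?N"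
        by (elim exE conjE)
      have "v \<in> ?W" "S v \<in> ?W"
        by (simp_all add: span_base)
      then have "R v = F v" "R (S v) = F (S v)"
        using R(2) by auto
      moreover have "R (S v) = S (R v)"
        using R(1) S by (rule centralizerD)
      ultimately show ?thesis
        by simp
    qed
    then show "F \<in> centralizer s X"
      using FE by (simp add: centralizer_def fun_eq_iff)
  qed
  moreover have "centralizer s X \<subseteq> topspace (function_topology s)"
    by (auto simp: topspace_function_topology[OF assms] centralizer_def)
  ultimately show ?thesis
    using closure_of_subset_eq by blast
qed

theorem theorem30:
  fixes s :: "'k::field \<Rightarrow> 'v::ab_group_add \<Rightarrow> 'v"
    and T :: "'v \<Rightarrow> 'v"
  assumes "vector_space s"
    and "T \<in> Endo s"
    and "\<exists>p :: 'k poly. p \<notin> range (\<lambda>c. [:c:]) \<and> poly_endo s p T = (\<lambda>_. 0)"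
  shows "centralizer s (centralizer s {T}) = function_topology s closure_of polys_in s T
    \<and> function_topology s closure_of polys_in s T = polys_in s T"
proof -
  interpret linear_endo s T
    using assms(2) by (simp add: Endo_def linear_endo_def)
  obtain p where p: "p \<notin> range (\<lambda>c. [:c:])" "ap p = (\<lambda>_. 0)"
    using assms(3) by blast
  have "p \<noteq> 0"
    using p(1) by (metis pCons_0_0 rangeI)
  then have eq: "centralizer s (centralizer s {T}) = polys_in s T"
    using double_centralizer_subset[of p] polys_in_subset_double_centralizer p(2) by auto
  have "closedin (function_topology s) (polys_in s T)"
    unfolding eq[symmetric]
    by (rule closedin_centralizer[OF assms(1)])
  then show ?thesis
    by (simp add: eq closure_of_closedin)
qed

end
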